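(* Let $s\ge1$ be an integer and $\varepsilon>0$. Consider the problem of finding $\lambda\in(0,s)$ such that $$\lambda\,(1-B(s,\lambda+\Omega))=\varepsilon,$$ where $\Omega=\Omega(\lambda)>0$ is the solution of $\Omega=(\lambda+\Omega)B(s,\lambda+\Omega)$. This problem has two, one or zero solutions $\lambda$ according as $\varepsilon<$, $=$ or $>$ $\sqrt{s}\,L_s(\hat\gamma_s)$, where $$L_s(\hat\gamma_s)=\frac{\hat\gamma_s}{\hat\gamma_s+\frac{1}{2\sqrt{s}}}\,(\sqrt{s}-\hat\gamma_s).$$
   Context: $B(s,\lambda)=\dfrac{\lambda^s/s!}{\sum_{k=0}^s\lambda^k/k!}$ is the Erlang B function. For $\gamma\le\sqrt{s}$ let $f_s(\gamma)=\sqrt{s}\,(1-\gamma/\sqrt{s})\,B(s,s-\gamma\sqrt{s})$. For $0<\gamma<\sqrt{s}$ let $a_s(\gamma)$ be the unique solution $a$ of $a=f_s(\gamma-a)$ (equivalently, for $\lambda=s-\gamma\sqrt{s}$, $\Omega=a_s(\gamma)\sqrt{s}$ is the unique solution of $\Omega=(\lambda+\Omega)B(s,\lambda+\Omega)$). Let $$L_s(\gamma)=\frac{(\sqrt{s}-\gamma)^2}{\sqrt{s}-\gamma+a_s(\gamma)},\qquad 0<\gamma<\sqrt{s},$$ and let $\hat\gamma_s$ be the unique solution $\gamma\in(0,\sqrt{s})$ of $\gamma\,a_s(\gamma)=\frac12(1-\gamma/\sqrt{s})$; this is the maximizer of $L_s$ on $(0,\sqrt{s})$. *)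

theory Defs
  imports Complex_Main
begin

definition erlang_B :: "nat \<Rightarrow> real \<Rightarrow> real" where
  "erlang_B s lam = (lam ^ s / fact s) / (\<Sum>k=0..s. lam ^ k / fact k)"

definition scaled_overflow :: "nat \<Rightarrow> real \<Rightarrow> real" where
  "scaled_overflow s \<gamma> =
     sqrt (real s) * (1 - \<gamma> / sqrt (real s)) * erlang_B s (real s - \<gamma> * sqrt (real s))"

text \<open>The function \<open>scaled_overflow s\<close> is only considered at arguments at most
  \<open>sqrt s\<close>, where the offered load \<open>s - \<gamma> * sqrt s\<close> is nonnegative;
  hence the domain condition on \<open>\<gamma> - a\<close>.\<close>

definition retrial_a :: "nat \<Rightarrow> real \<Rightarrow> real" where
  "retrial_a s \<gamma> =
     (THE a. \<gamma> - a \<le> sqrt (real s) \<and> a = scaled_overflow s (\<gamma> - a))"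

definition retrial_rate :: "nat \<Rightarrow> real \<Rightarrow> real" where
  "retrial_rate s lam = (THE \<Omega>. \<Omega> > 0 \<and> \<Omega> = (lam + \<Omega>) * erlang_B s (lam + \<Omega>))"

definition L_fun :: "nat \<Rightarrow> real \<Rightarrow> real" where
  "L_fun s \<gamma> = (sqrt (real s) - \<gamma>)\<^sup>2 / (sqrt (real s) - \<gamma> + retrial_a s \<gamma>)"

definition gamma_hat :: "nat \<Rightarrow> real" where
  "gamma_hat s =
     (THE \<gamma>. 0 < \<gamma> \<and> \<gamma> < sqrt (real s) \<and>
        \<gamma> * retrial_a s \<gamma> = 1 / 2 * (1 - \<gamma> / sqrt (real s)))"

definition load_solutions :: "nat \<Rightarrow> real \<Rightarrow> real set" where
  "load_solutions s \<epsilon> =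
     {lam. 0 < lam \<and> lam < real s \<and> lam * (1 - erlang_B s (lam + retrial_rate s lam)) = \<epsilon>}"

end

theory Submission
  imports Defs "HOL-Computational_Algebra.Polynomial"
begin

text \<open>
  Write \<open>x = \<lambda> + \<Omega>\<close> for the total offered load and \<open>y = 1 / x\<close>. The equation for
  \<open>\<Omega>\<close> says that \<open>\<lambda> = x (1 - B(s, x))\<close>, the load carried by the servers when \<open>x\<close> is offered.
  So \<open>\<lambda>\<close> is an explicit function of \<open>x\<close>, and \<open>x\<close> is the convenient unknown. Moreover,
  \<open>1 / B(s, x) = u(y)\<close> is a polynomial in \<open>y\<close> with coefficients
  \<open>c\<^sub>j = s (s - 1) \<dots> (s - j + 1)\<close>. With \<open>u = 1 + y v\<close> this gives \<open>\<lambda> = v / u\<close>, which decreases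
  strictly from \<open>s\<close> to \<open>0\<close> as \<open>y\<close> runs over \<open>(0, \<infinity>)\<close>. Hence every \<open>\<lambda> \<in> (0, s)\<close> is attained
  exactly once, \<open>\<Omega>(\<lambda>) = 1 / y - \<lambda>\<close>, and the number of solutions is the number of \<open>y > 0\<close>
  with \<open>h(y) = \<epsilon>\<close>, where \<open>h(y) = \<lambda> (1 - B) = y (v / u)\<^sup>2\<close>.

  The function \<open>h\<close> tends to \<open>0\<close> at both ends, because \<open>h \<le> s\<^sup>2 y\<close> and \<open>h \<le> 1 / y\<close>. It is
  unimodal because \<open>y h' / h = 2 p - 1\<close> with \<open>p = u' / (u v)\<close>, and \<open>p\<close> decreases strictly from \<open>1\<close>
  to \<open>0\<close>. This monotonicity is the heart of the proof (\<open>elasticity_less\<close>). A quotient of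
  polynomials with nonnegative coefficients decreases on \<open>(0, \<infinity>)\<close> if the quotients of their
  coefficients decrease (\<open>poly_cross_less\<close>), so the claim reduces to an inequality between
  consecutive convolution sums of the \<open>c\<^sub>j\<close> (\<open>convolution_step\<close>).

  Finally \<open>s u - v = y u'\<close> turns \<open>p = 1 / 2\<close> into the equation that defines \<open>\<gamma>\<close>-hat, so that
  \<open>\<gamma>\<close>-hat \<open>= (s - \<lambda>) / \<surd>s\<close> at the mode of \<open>h\<close>; the value of \<open>\<surd>s L\<^sub>s\<close> there is the maximum of \<open>h\<close>.
\<close>

section \<open>Quotients of polynomials with monotone coefficient ratios\<close>

text \<open>Under the cross inequalities \<open>P / Q\<close> weighs the coefficient quotients \<open>p\<^sub>i / q\<^sub>i\<close>, which
  decrease in \<open>i\<close>, by \<open>q\<^sub>i t\<^sup>i\<close>, and a larger \<open>t\<close> moves weight to larger \<open>i\<close>. The proof is the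
  symmetrization of Chebyshev's sum inequality: both sides are double sums, and adding the copy
  with \<open>i\<close> and \<open>j\<close> exchanged makes every term of the difference nonnegative. Stating the
  hypothesis without division admits zero coefficients.\<close>

lemma poly_cross_less:
  fixes P Q :: "real poly"
  assumes cross: "\<And>i j. i < j \<Longrightarrow> coeff P j * coeff Q i \<le> coeff P i * coeff Q j"
    and strict: "i0 < j0" "coeff P j0 * coeff Q i0 < coeff P i0 * coeff Q j0"
    and y: "0 < y" "y < z"
  shows "poly P z * poly Q y < poly P y * poly Q z"
proof -
  define n where "n = max j0 (max (degree P) (degree Q))"
  have pP: "poly P t = (\<Sum>i\<le>n. coeff P i * t ^ i)" for t
    unfolding poly_altdef by (rule sum.mono_neutral_left) (auto simp: n_def coeff_eq_0)
  have pQ: "poly Q t = (\<Sum>i\<le>n. coeff Q i * t ^ i)" for t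
    unfolding poly_altdef by (rule sum.mono_neutral_left) (auto simp: n_def coeff_eq_0)
  define w where "w i j = y ^ i * z ^ j - z ^ i * y ^ j" for i j
  have w_pos: "w i j > 0" if less: "i < j" for i j
  proof -
    obtain d where d: "d > 0" "i + d = j" using less_imp_add_positive[OF less] by blast
    have "y ^ d < z ^ d" using y d by (intro power_strict_mono) auto
    moreover have "w i j = y ^ i * z ^ i * (z ^ d - y ^ d)"
      by (simp add: w_def power_add algebra_simps flip: d(2))
    ultimately show ?thesis using y by simp
  qed
  have w_anti: "w j i = - w i j" for i j by (simp add: w_def)
  define T where "T i j = (coeff P i * coeff Q j - coeff P j * coeff Q i) * w i j" for i j
  have T_sym: "T j i = T i j" for i j by (simp add: T_def w_anti[of j i] algebra_simps)
  have T_less: "T i j \<ge> 0" if "i < j" for i j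
    using w_pos[OF that] cross[OF that] by (simp add: T_def)
  have T_ge: "T i j \<ge> 0" for i j
    using T_less[of i j] T_less[of j i] T_sym[of i j] by (cases i j rule: linorder_cases) (auto simp: T_def)
  define E where "E i j = coeff P i * coeff Q j * w i j" for i j
  have expand: "poly P y * poly Q z - poly P z * poly Q y = (\<Sum>i\<le>n. \<Sum>j\<le>n. E i j)"
    unfolding pP pQ sum_product sum_subtractf [symmetric]
    by (intro sum.cong refl) (simp add: E_def w_def algebra_simps)
  have "2 * (poly P y * poly Q z - poly P z * poly Q y)
      = (\<Sum>i\<le>n. \<Sum>j\<le>n. E i j) + (\<Sum>i\<le>n. \<Sum>j\<le>n. E j i)"
    unfolding mult_2 expand by (simp only: sum.swap[of "\<lambda>i j. E j i"])
  also have "\<dots> = (\<Sum>i\<le>n. \<Sum>j\<le>n. T i j)"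
    unfolding sum.distrib [symmetric]
  proof (intro sum.cong refl)
    fix i j
    show "E i j + E j i = T i j"
      unfolding E_def T_def w_anti[of j i] by (simp add: algebra_simps)
  qed
  also have "\<dots> > 0"
  proof -
    have "0 < T i0 j0" using w_pos[OF strict(1)] strict(2) by (simp add: T_def)
    also have "\<dots> \<le> (\<Sum>j\<le>n. T i0 j)"
      by (rule member_le_sum) (use T_ge in \<open>auto simp: n_def\<close>)
    also have "\<dots> \<le> (\<Sum>i\<le>n. \<Sum>j\<le>n. T i j)"
      by (rule member_le_sum[where f = "\<lambda>i. \<Sum>j\<le>n. T i j"])
        (use T_ge strict(1) in \<open>auto simp: n_def intro: sum_nonneg\<close>)
    finally show ?thesis .
  qed
  finally show ?thesis by simp
qed

lemma poly_mono_coeff: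
  fixes P Q :: "real poly"
  assumes "\<And>i. coeff P i \<le> coeff Q i" "t \<ge> 0"
  shows "poly P t \<le> poly Q t"
proof -
  define n where "n = max (degree P) (degree Q)"
  have "poly P t = (\<Sum>i\<le>n. coeff P i * t ^ i)"
    unfolding poly_altdef by (rule sum.mono_neutral_left) (auto simp: n_def coeff_eq_0)
  also have "\<dots> \<le> (\<Sum>i\<le>n. coeff Q i * t ^ i)"
    using assms by (intro sum_mono mult_right_mono) auto
  also have "\<dots> = poly Q t"
    unfolding poly_altdef by (rule sum.mono_neutral_right) (auto simp: n_def coeff_eq_0)
  finally show ?thesis .
qed

section \<open>The reciprocal of the Erlang B function as a polynomial\<close>

text \<open>The falling factorial as a real product vanishes for \<open>j > s\<close>, so its recurrence holds for
  all \<open>j\<close> and the coefficient identities below require no case distinction at the degree.\<close>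

definition falling :: "nat \<Rightarrow> nat \<Rightarrow> real" where
  "falling s j = (\<Prod>i<j. real s - real i)"

definition recip_B :: "nat \<Rightarrow> real poly" where
  "recip_B s = (\<Sum>j\<le>s. monom (falling s j) j)"

definition recip_B_tail :: "nat \<Rightarrow> real poly" where
  "recip_B_tail s = poly_shift 1 (recip_B s)"

lemma falling_0 [simp]: "falling s 0 = 1" by (simp add: falling_def)

lemma falling_Suc: "falling s (Suc j) = (real s - real j) * falling s j"
  by (simp add: falling_def)

lemma falling_eq_0: "j > s \<Longrightarrow> falling s j = 0"
  by (auto simp: falling_def)

lemma falling_pos: "j \<le> s \<Longrightarrow> falling s j > 0"
  by (auto simp: falling_def intro!: prod_pos)

lemma falling_nonneg: "falling s j \<ge> 0"
  using falling_pos[of j s] falling_eq_0[of s j] by (cases "j \<le> s") auto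

lemma falling_fact: "j \<le> s \<Longrightarrow> falling s j * fact (s - j) = fact s"
proof (induction j)
  case (Suc j)
  have "s - j = Suc (s - Suc j)" using Suc.prems by simp
  then have "(fact (s - j) :: real) = real (s - j) * fact (s - Suc j)" by (metis fact_Suc)
  then show ?case using Suc by (simp add: falling_Suc of_nat_diff mult_ac)
qed simp

lemma coeff_recip_B [simp]: "coeff (recip_B s) j = falling s j"
  by (simp add: recip_B_def coeff_sum falling_eq_0)

lemma coeff_recip_B_tail [simp]: "coeff (recip_B_tail s) j = falling s (Suc j)"
  by (simp add: recip_B_tail_def coeff_poly_shift)

lemma recip_B_pCons: "recip_B s = pCons 1 (recip_B_tail s)"
  by (rule poly_eqI) (auto simp: coeff_pCons split: nat.splits)

lemma recip_B_eq_tail: "poly (recip_B s) y = 1 + y * poly (recip_B_tail s) y"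
  by (subst recip_B_pCons) simp

lemma recip_B_tail_ge: assumes "y \<ge> 0" shows "real s \<le> poly (recip_B_tail s) y"
  using poly_mono_coeff[of "[:real s:]" "recip_B_tail s" y] assms
  by (auto simp: coeff_pCons falling_Suc[of s 0] falling_nonneg split: nat.splits)

lemma recip_B_ge_1: assumes "y \<ge> 0" shows "poly (recip_B s) y \<ge> 1"
  using recip_B_tail_ge[OF assms, of s] assms by (simp add: recip_B_eq_tail)

text \<open>Dividing the denominator of the Erlang B function by its top term \<open>x\<^sup>s / s!\<close> and
  summing in reverse order leaves \<open>\<Sum>\<^sub>j (s! / (s - j)!) x\<^sup>-\<^sup>j\<close>.\<close>

lemma erlang_B_recip:
  assumes "x > 0"
  shows "erlang_B s x = 1 / poly (recip_B s) (1 / x)"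
proof -
  have summand: "x ^ (s - j) / fact (s - j) = x ^ s / fact s * (falling s j * (1 / x) ^ j)"
    if "j \<le> s" for j
  proof -
    have "x ^ s = x ^ (s - j) * x ^ j" using that by (simp flip: power_add)
    moreover have "fact s = falling s j * fact (s - j)" using falling_fact[OF that] by simp
    ultimately show ?thesis
      using assms falling_pos[OF that] by (simp add: field_simps)
  qed
  have "(\<Sum>k=0..s. x ^ k / fact k) = (\<Sum>j\<le>s. x ^ (s - j) / fact (s - j))"
    by (rule sum.reindex_bij_witness[of _ "\<lambda>j. s - j" "\<lambda>j. s - j"]) auto
  also have "\<dots> = (\<Sum>j\<le>s. x ^ s / fact s * (falling s j * (1 / x) ^ j))"
    using summand by (intro sum.cong) auto
  also have "\<dots> = x ^ s / fact s * poly (recip_B s) (1 / x)"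
    by (simp add: recip_B_def poly_sum poly_monom sum_distrib_left)
  finally show ?thesis using assms by (simp add: erlang_B_def)
qed

text \<open>The recurrence \<open>c\<^sub>j\<^sub>+\<^sub>1 = (s - j) c\<^sub>j\<close> read as an identity of generating functions. It
  links the derivative of the blocking probability to \<open>s - \<lambda>\<close>, the mean number of idle servers.\<close>

lemma pderiv_recip_B:
  "y * poly (pderiv (recip_B s)) y = real s * poly (recip_B s) y - poly (recip_B_tail s) y"
proof -
  have "pCons 0 (pderiv (recip_B s)) = smult (real s) (recip_B s) - recip_B_tail s"
    by (rule poly_eqI) (auto simp: coeff_pCons coeff_pderiv falling_Suc algebra_simps split: nat.splits)
  then have "poly (pCons 0 (pderiv (recip_B s))) y = poly (smult (real s) (recip_B s) - recip_B_tail s) y"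
    by simp
  then show ?thesis by simp
qed

lemma pderiv_recip_B_le:
  assumes "y \<ge> 0"
  shows "poly (pderiv (recip_B s)) y \<le> real s * poly (recip_B_tail s) y"
proof -
  have "poly (pderiv (recip_B s)) y \<le> poly (smult (real s) (recip_B_tail s)) y"
  proof (rule poly_mono_coeff[OF _ assms])
    fix i
    show "coeff (pderiv (recip_B s)) i \<le> coeff (smult (real s) (recip_B_tail s)) i"
      by (cases "Suc i \<le> s")
        (auto simp: coeff_pderiv falling_eq_0 intro!: mult_right_mono falling_nonneg)
  qed
  then show ?thesis by simp
qed

section \<open>The carried load as a function of the reciprocal offered load\<close>

text \<open>With \<open>x = 1 / y\<close> offered, the carried load \<open>x (1 - B(s, x))\<close> is
  \<open>(1 / y) (1 - 1 / u) = v / u\<close>. The quotient also makes sense at \<open>y = 0\<close>, infinite offered load,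
  where all \<open>s\<close> servers are busy; this endpoint serves the intermediate value arguments.\<close>

definition carried :: "nat \<Rightarrow> real \<Rightarrow> real" where
  "carried s y = poly (recip_B_tail s) y / poly (recip_B s) y"

text \<open>The logarithmic derivative \<open>d log (1 - B) / d log y\<close> of the acceptance probability
  \<open>1 - B = y v / u\<close>, in the form that remains defined at \<open>y = 0\<close>.\<close>

definition elasticity :: "nat \<Rightarrow> real \<Rightarrow> real" where
  "elasticity s y = poly (pderiv (recip_B s)) y / (poly (recip_B s) y * poly (recip_B_tail s) y)"

text \<open>The rate \<open>\<lambda> (1 - B)\<close> of customers admitted at their first attempt, with
  \<open>1 - B = y \<lambda>\<close> substituted.\<close>

definition goodput :: "nat \<Rightarrow> real \<Rightarrow> real" where
  "goodput s y = y * (carried s y)\<^sup>2"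

lemma recip_pos: "y \<ge> 0 \<Longrightarrow> poly (recip_B s) y > 0"
  using recip_B_ge_1[of y s] by linarith

lemma tail_pos: "s \<ge> 1 \<Longrightarrow> y \<ge> 0 \<Longrightarrow> poly (recip_B_tail s) y > 0"
  using recip_B_tail_ge[of y s] by linarith

lemma recip_nonzero: "y \<ge> 0 \<Longrightarrow> poly (recip_B s) y \<noteq> 0"
  using recip_pos[of y s] by linarith

lemma tail_nonzero: "s \<ge> 1 \<Longrightarrow> y \<ge> 0 \<Longrightarrow> poly (recip_B_tail s) y \<noteq> 0"
  using tail_pos[of s y] by linarith

lemma carried_pos: "s \<ge> 1 \<Longrightarrow> y \<ge> 0 \<Longrightarrow> carried s y > 0"
  by (simp add: carried_def recip_pos tail_pos)

lemma carried_0: "carried s 0 = real s"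
  by (simp add: carried_def poly_0_coeff_0 falling_Suc)

text \<open>The coefficient quotients are \<open>c\<^sub>j\<^sub>+\<^sub>1 / c\<^sub>j = s - j\<close>.\<close>

lemma carried_less:
  assumes "s \<ge> 1" "0 < y" "y < z"
  shows "carried s z < carried s y"
proof -
  have "poly (recip_B_tail s) z * poly (recip_B s) y < poly (recip_B_tail s) y * poly (recip_B s) z"
  proof (rule poly_cross_less[where ?i0.0 = 0 and ?j0.0 = 1])
    fix i j :: nat assume "i < j"
    then have "(real s - real j) * (falling s j * falling s i) \<le> (real s - real i) * (falling s j * falling s i)"
      by (intro mult_right_mono) (auto simp: falling_nonneg)
    then show "coeff (recip_B_tail s) j * coeff (recip_B s) i \<le> coeff (recip_B_tail s) i * coeff (recip_B s) j"
      by (simp add: falling_Suc mult_ac)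
  qed (use assms in \<open>auto simp: falling_Suc\<close>)
  then show ?thesis using assms recip_pos[of y s] recip_pos[of z s]
    by (simp add: carried_def field_simps)
qed

lemma accepted_fraction:
  assumes "y > 0" shows "y * carried s y = 1 - 1 / poly (recip_B s) y"
proof -
  have "y * poly (recip_B_tail s) y = poly (recip_B s) y - 1" by (simp add: recip_B_eq_tail)
  then show ?thesis using recip_nonzero[of y s] assms by (simp add: carried_def diff_divide_distrib)
qed

lemma carried_less_inverse:
  assumes "y > 0" shows "y * carried s y < 1"
  using accepted_fraction[OF assms, of s] recip_pos[of y s] assms by simp

lemma continuous_carried: "S \<subseteq> {0..} \<Longrightarrow> continuous_on S (carried s)"
  unfolding carried_def by (intro continuous_on_divide continuous_on_poly continuous_on_id) (simp add: subset_iff recip_nonzero)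

lemma carried_less_s:
  assumes "s \<ge> 1" "y > 0" shows "carried s y < real s"
proof -
  have "carried s y < carried s (y/2)" using assms by (intro carried_less) auto
  also have "carried s (y / 2) \<le> real s"
  proof -
    have "poly (recip_B_tail s) (y/2) \<le> poly (smult (real s) (recip_B s)) (y/2)"
    proof (rule poly_mono_coeff)
      fix i show "coeff (recip_B_tail s) i \<le> coeff (smult (real s) (recip_B s)) i"
        by (auto simp: falling_Suc intro!: mult_right_mono falling_nonneg)
    qed (use assms in auto)
    then show ?thesis using recip_pos[of "y/2" s] assms by (simp add: carried_def field_simps)
  qed
  finally show ?thesis .
qed

lemma carried_inj:
  assumes "s \<ge> 1" shows "inj_on (carried s) {0<..}"
proof (rule inj_onI)
  fix y z assume "y \<in> {0<..}" "z \<in> {0<..}" "carried s y = carried s z"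
  then show "y = z"
    using carried_less[OF assms, of y z] carried_less[OF assms, of z y]
    by (cases y z rule: linorder_cases) auto
qed

text \<open>The left end of the interval is \<open>y = 0\<close>, where the carried load is \<open>s\<close>; at the right end
  \<open>y = 1 / l\<close> it is at most \<open>l\<close> since \<open>y \<lambda> < 1\<close>.\<close>

lemma carried_onto:
  assumes "s \<ge> 1" "0 < l" "l < real s"
  obtains y where "y > 0" "carried s y = l"
proof -
  have "carried s (1/l) \<le> l" using carried_less_inverse[of "1/l" s] assms by (simp add: field_simps)
  then obtain y where "0 \<le> y" "y \<le> 1/l" "carried s y = l"
    using IVT2'[of "carried s" "1/l" l 0] assms continuous_carried[of "{0..1/l}" s] by (auto simp: carried_0)
  moreover have "y \<noteq> 0" using calculation carried_0[of s] assms by auto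
  ultimately show ?thesis using that[of y] by simp
qed

section \<open>Monotonicity of the elasticity\<close>

text \<open>Put \<open>X k = c\<^sub>k c\<^sub>m\<^sub>+\<^sub>1\<^sub>-\<^sub>k\<close> and \<open>Y k = c\<^sub>k c\<^sub>m\<^sub>-\<^sub>k\<close>. The recurrence, applied to either
  factor, bounds both \<open>X k\<close> and \<open>X (k + 1)\<close> from below by \<open>(s - m) Y k\<close>. There is one more \<open>X\<close> than
  there are \<open>Y\<close>'s, so using one of the two bounds alone loses too much. Splitting
  \<open>m X k = (m - k) X k + k X k\<close> and using the first bound on the first part and the second bound on
  the second part gives each \<open>Y k\<close> the total weight \<open>(m - k) + (k + 1) = m + 1\<close>.\<close>

lemma convolution_step:
  assumes "0 < m" "m < s"
  shows "(real m + 1) * (real s - real m) * (\<Sum>k<m. falling s k * falling s (m - k))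
    \<le> real m * (\<Sum>k\<le>m. falling s k * falling s (Suc m - k))"
proof -
  define X where "X k = falling s k * falling s (Suc m - k)" for k
  define Y where "Y k = falling s k * falling s (m - k)" for k
  have X1: "(real s - real m) * Y k \<le> X k" if "k < m" for k
  proof -
    have "X k = (real s - real (m - k)) * Y k"
      using that by (simp add: X_def Y_def Suc_diff_le falling_Suc)
    then show ?thesis using that
      by (auto simp: Y_def intro!: mult_right_mono mult_nonneg_nonneg falling_nonneg)
  qed
  have X2: "(real s - real m) * Y k \<le> X (Suc k)" if "k < m" for k
  proof -
    have "X (Suc k) = (real s - real k) * Y k"
      by (simp add: X_def Y_def falling_Suc)
    then show ?thesis using that
      by (auto simp: Y_def intro!: mult_right_mono mult_nonneg_nonneg falling_nonneg)
  qed
  have "real m * (\<Sum>k\<le>m. X k) = (\<Sum>k\<le>m. (real m - real k) * X k) + (\<Sum>k\<le>m. real k * X k)"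
    by (simp add: sum_distrib_left sum.distrib [symmetric] algebra_simps)
  also have "(\<Sum>k\<le>m. (real m - real k) * X k) = (\<Sum>k<m. (real m - real k) * X k)"
    by (simp flip: lessThan_Suc_atMost)
  also have "(\<Sum>k\<le>m. real k * X k) = (\<Sum>k<m. (real k + 1) * X (Suc k))"
    unfolding lessThan_Suc_atMost [symmetric] sum.lessThan_Suc_shift by (simp add: add.commute)
  also have "(\<Sum>k<m. (real m - real k) * X k) + \<dots>
      \<ge> (\<Sum>k<m. (real m - real k) * ((real s - real m) * Y k))
        + (\<Sum>k<m. (real k + 1) * ((real s - real m) * Y k))"
    by (intro add_mono sum_mono mult_left_mono X1 X2) auto
  also have "(\<Sum>k<m. (real m - real k) * ((real s - real m) * Y k))
        + (\<Sum>k<m. (real k + 1) * ((real s - real m) * Y k))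
      = (real m + 1) * (real s - real m) * (\<Sum>k<m. Y k)"
    by (simp add: sum_distrib_left sum.distrib [symmetric] algebra_simps)
  finally show ?thesis by (simp add: X_def Y_def)
qed

definition convolution :: "nat \<Rightarrow> nat \<Rightarrow> real" where
  "convolution s i = (\<Sum>k\<le>i. falling s k * falling s (Suc i - k))"

lemma convolution_nonneg: "convolution s i \<ge> 0"
  by (auto simp: convolution_def intro!: sum_nonneg mult_nonneg_nonneg falling_nonneg)

lemma coeff_recip_B_mult_tail: "coeff (recip_B s * recip_B_tail s) i = convolution s i"
  by (simp add: coeff_mult convolution_def Suc_diff_le)

text \<open>The quotient of the \<open>i\<close>-th coefficients of \<open>u v\<close> and \<open>u'\<close>, as long as the latter is
  nonzero.\<close>

lemma convolution_ratio_mono: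
  assumes "i \<le> j" "j < s"
  shows "convolution s i / (real (Suc i) * falling s (Suc i)) \<le> convolution s j / (real (Suc j) * falling s (Suc j))"
  using assms
proof (induction j rule: dec_induct)
  case (step j)
  define m where "m = Suc j"
  have m: "0 < m" "m < s" using step by (auto simp: m_def)
  have f: "falling s m > 0" "falling s (Suc m) = (real s - real m) * falling s m" "real s - real m > 0"
    using m by (auto intro: falling_pos simp: falling_Suc)
  have "convolution s j / (real m * falling s m) \<le> convolution s m / (real (Suc m) * falling s (Suc m))"
  proof -
    have "(real m + 1) * (real s - real m) * convolution s j \<le> real m * convolution s m"
      using convolution_step[OF m] by (simp add: convolution_def m_def lessThan_Suc_atMost)
    then have "falling s m * ((real m + 1) * (real s - real m) * convolution s j) \<le> falling s m * (real m * convolution s m)"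
      using f by (intro mult_left_mono) auto
    then show ?thesis using f m by (simp add: f(2) divide_le_eq le_divide_eq mult_ac add.commute)
  qed
  then show ?case using step by (auto simp: m_def)
qed simp

lemma elasticity_less:
  assumes "s \<ge> 1" "0 < y" "y < z"
  shows "elasticity s z < elasticity s y"
proof -
  let ?N = "pderiv (recip_B s)" and ?D = "recip_B s * recip_B_tail s"
  have N: "coeff ?N i = real (Suc i) * falling s (Suc i)" for i by (simp add: coeff_pderiv)
  \<comment> \<open>Strictness comes from the pair of indices \<open>(0, s)\<close>: \<open>u'\<close> has degree below \<open>s\<close>,
    whereas \<open>u v\<close> has degree \<open>2 s - 1 \<ge> s\<close> and positive coefficients up to it.\<close>
  have "poly ?N z * poly ?D y < poly ?N y * poly ?D z"
  proof (rule poly_cross_less[where ?i0.0 = 0 and ?j0.0 = s])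
    fix i j :: nat assume ij: "i < j"
    show "coeff ?N j * coeff ?D i \<le> coeff ?N i * coeff ?D j"
    proof (cases "j < s")
      case True
      then have "falling s (Suc i) > 0" "falling s (Suc j) > 0" using ij by (auto intro: falling_pos)
      then have "coeff ?N i > 0" "coeff ?N j > 0" unfolding N by simp_all
      then show ?thesis
        using convolution_ratio_mono[of i j s] ij True unfolding N coeff_recip_B_mult_tail
        by (simp only: divide_le_eq le_divide_eq) (simp add: field_simps)
    next
      case False
      then show ?thesis unfolding N coeff_recip_B_mult_tail
        by (auto simp: falling_eq_0 intro!: mult_nonneg_nonneg convolution_nonneg falling_nonneg)
    qed
  next
    have "0 < falling s s * falling s (Suc s - s)"
      using assms by (intro mult_pos_pos falling_pos) auto
    also have "\<dots> \<le> convolution s s"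
      unfolding convolution_def
      by (rule member_le_sum) (auto intro!: mult_nonneg_nonneg falling_nonneg)
    finally show "coeff ?N s * coeff ?D 0 < coeff ?N 0 * coeff ?D s"
      using assms unfolding N coeff_recip_B_mult_tail by (simp add: falling_eq_0 falling_Suc)
  qed (use assms in auto)
  then show ?thesis using assms recip_pos[of y s] recip_pos[of z s] tail_pos[of s y] tail_pos[of s z]
    by (simp add: elasticity_def field_simps)
qed

lemma continuous_elasticity: "s \<ge> 1 \<Longrightarrow> S \<subseteq> {0..} \<Longrightarrow> continuous_on S (elasticity s)"
  unfolding elasticity_def
  by (intro continuous_on_divide continuous_on_mult continuous_on_poly continuous_on_id) (simp add: subset_iff recip_nonzero tail_nonzero)

lemma elasticity_0: "s \<ge> 1 \<Longrightarrow> elasticity s 0 = 1"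
  by (simp add: elasticity_def poly_0_coeff_0 coeff_pderiv falling_Suc)

lemma elasticity_le:
  assumes "s \<ge> 1" "y \<ge> 0"
  shows "elasticity s y \<le> real s / (1 + y * real s)"
proof -
  let ?u = "poly (recip_B s) y" and ?v = "poly (recip_B_tail s) y"
  have pos: "?u > 0" "?v > 0" using recip_pos tail_pos assms by auto
  have "elasticity s y \<le> (real s * ?v) / (?u * ?v)"
    unfolding elasticity_def using pos assms by (intro divide_right_mono pderiv_recip_B_le) auto
  also have "\<dots> = real s / ?u" using pos by simp
  also have "\<dots> \<le> real s / (1 + y * real s)"
    using assms recip_B_tail_ge[of y s]
    by (intro divide_left_mono) (auto simp: recip_B_eq_tail intro!: mult_left_mono mult_pos_pos add_pos_nonneg)
  finally show ?thesis .
qed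

text \<open>The point \<open>2\<close> works for every \<open>s\<close>, as \<open>s / (1 + 2 s) < 1 / 2\<close>.\<close>

lemma elasticity_half:
  assumes "s \<ge> 1"
  obtains y where "y > 0" "elasticity s y = 1/2"
proof -
  have "elasticity s 2 \<le> real s / (1 + 2 * real s)" using elasticity_le[of s 2] assms by simp
  also have "\<dots> \<le> 1/2" by (simp add: field_simps)
  finally have "elasticity s 2 \<le> 1/2" .
  then obtain y where "0 \<le> y" "elasticity s y = 1/2"
    using IVT2'[of "elasticity s" 2 "1/2" 0] assms continuous_elasticity[of s "{0..2}"]
    by (auto simp: elasticity_0)
  moreover have "y \<noteq> 0" using calculation elasticity_0[OF assms] by auto
  ultimately show ?thesis using that[of y] by simp
qed

text \<open>This relation between \<open>s - \<lambda>\<close> and the elasticity is what identifies the mode of the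
  goodput with the defining equation of \<^const>\<open>gamma_hat\<close>.\<close>

lemma elasticity_carried:
  assumes "s \<ge> 1" "y > 0"
  shows "real s - carried s y = y * poly (recip_B s) y * carried s y * elasticity s y"
proof -
  have pos: "poly (recip_B s) y > 0" "poly (recip_B_tail s) y > 0" using recip_pos tail_pos assms by auto
  then show ?thesis using pderiv_recip_B[of y s] assms
    by (simp add: carried_def elasticity_def field_simps)
qed

section \<open>Unimodality of the goodput\<close>

text \<open>The goodput is \<open>(1 - B)\<^sup>2 / y\<close>, so its elasticity is \<open>2 p - 1\<close>, where \<open>p\<close> is the elasticity
  of \<open>1 - B\<close>.\<close>

lemma goodput_deriv:
  assumes "s \<ge> 1" "y > 0"
  shows "(goodput s has_real_derivative goodput s y / y * (2 * elasticity s y - 1)) (at y)"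
proof -
  define u where "u = poly (recip_B s) y"
  define v where "v = poly (recip_B_tail s) y"
  define u' where "u' = poly (pderiv (recip_B s)) y"
  define v' where "v' = poly (pderiv (recip_B_tail s)) y"
  have pos: "u > 0" "v > 0" using recip_pos tail_pos assms by (auto simp: u_def v_def)
  have uv: "u = 1 + y * v" by (simp add: u_def v_def recip_B_eq_tail)
  have uv': "u' = v + y * v'"
    by (simp add: recip_B_pCons u'_def v_def v'_def pderiv_pCons)
  define c' where "c' = (v' * u - v * u') / (u * u)"
  have "((\<lambda>y. poly (recip_B_tail s) y / poly (recip_B s) y) has_real_derivative c') (at y)"
    unfolding c'_def u_def v_def u'_def v'_def
    using pos by (intro DERIV_divide poly_DERIV) (simp add: u_def)
  then have "(carried s has_real_derivative c') (at y)"
    by (simp add: carried_def [abs_def])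
  from DERIV_mult [OF DERIV_ident DERIV_power [OF this, of 2]]
  have "(goodput s has_real_derivative (v / u)\<^sup>2 + y * (2 * (v / u) * c')) (at y)"
    by (simp add: goodput_def [abs_def] carried_def u_def v_def mult_ac add.commute)
  moreover have "(v / u)\<^sup>2 + y * (2 * (v / u) * c')
      = goodput s y / y * (2 * elasticity s y - 1)"
  proof -
    have "y * (v' * u - v * u') = u' - v * u"
    proof -
      have "y * (v' * u - v * u') = (y * v') * u - (y * v) * u'" by (simp add: algebra_simps)
      also have "\<dots> = (u' - v) * u - (u - 1) * u'" using uv uv' by simp
      finally have "y * (v' * u - v * u') = (u' - v) * u - (u - 1) * u'" .
      then show ?thesis by (simp add: algebra_simps)
    qed
    then have "y * c' = (u' - v * u) / (u * u)" by (simp add: c'_def)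
    moreover have "(v / u)\<^sup>2 + y * (2 * (v / u) * c') = (v / u)\<^sup>2 + 2 * (v / u) * (y * c')"
      by simp
    ultimately have "(v / u)\<^sup>2 + y * (2 * (v / u) * c')
        = (v / u)\<^sup>2 + 2 * (v / u) * ((u' - v * u) / (u * u))"
      by (simp only:)
    also have "\<dots> = (v / u)\<^sup>2 * (2 * (u' / (u * v)) - 1)"
      using pos by (simp add: field_simps power2_eq_square)
    finally show ?thesis using assms
      by (simp add: goodput_def carried_def elasticity_def u_def v_def u'_def)
  qed
  ultimately show ?thesis by simp
qed

lemma goodput_pos: "s \<ge> 1 \<Longrightarrow> y > 0 \<Longrightarrow> goodput s y > 0"
  using carried_pos[of s y] by (simp add: goodput_def)

lemma goodput_inc:
  assumes "s \<ge> 1" "elasticity s q = 1/2" "0 < a" "a < b" "b \<le> q"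
  shows "goodput s a < goodput s b"
proof (rule DERIV_pos_imp_increasing_open[OF \<open>a < b\<close>])
  fix x assume x: "a < x" "x < b"
  then have "elasticity s x > 1/2" using elasticity_less[of s x q] assms by auto
  then have "goodput s x / x * (2 * elasticity s x - 1) > 0"
    using goodput_pos[of s x] x assms by simp
  then show "\<exists>d. (goodput s has_real_derivative d) (at x) \<and> d > 0"
    using goodput_deriv[of s x] x assms by force
next
  show "continuous_on {a..b} (goodput s)"
    unfolding goodput_def using assms by (intro continuous_intros continuous_carried) auto
qed

lemma goodput_dec:
  assumes "s \<ge> 1" "elasticity s q = 1/2" "0 < q" "q \<le> a" "a < b"
  shows "goodput s b < goodput s a"
proof (rule DERIV_neg_imp_decreasing_open[OF \<open>a < b\<close>])
  fix x assume x: "a < x" "x < b"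
  then have "elasticity s x < 1/2" using elasticity_less[of s q x] assms by auto
  then have "goodput s x / x * (2 * elasticity s x - 1) < 0"
    using goodput_pos[of s x] x assms by (intro mult_pos_neg) auto
  then show "\<exists>d. (goodput s has_real_derivative d) (at x) \<and> d < 0"
    using goodput_deriv[of s x] x assms by force
next
  show "continuous_on {a..b} (goodput s)"
    unfolding goodput_def using assms by (intro continuous_intros continuous_carried) auto
qed

lemma goodput_le:
  assumes "s \<ge> 1" "y > 0"
  shows "goodput s y \<le> y * (real s)\<^sup>2" "goodput s y \<le> 1 / y"
proof -
  show "goodput s y \<le> y * (real s)\<^sup>2"
    unfolding goodput_def using assms carried_less_s[of s y] carried_pos[of s y]
    by (intro mult_left_mono power_mono) auto
  have "(y * carried s y)\<^sup>2 \<le> 1\<^sup>2"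
    using assms carried_pos[of s y] carried_less_inverse[of y s] by (intro power_mono) auto
  then show "goodput s y \<le> 1 / y"
    using assms by (simp add: goodput_def field_simps power2_eq_square)
qed

text \<open>Below the maximum there is one solution on each branch: the bounds \<open>h \<le> s\<^sup>2 y\<close> and
  \<open>h \<le> 1 / y\<close> provide the outer endpoints \<open>\<epsilon> / s\<^sup>2\<close> and \<open>1 / \<epsilon>\<close>, where \<open>h \<le> \<epsilon>\<close>.\<close>

lemma goodput_level:
  assumes s: "s \<ge> 1" and q: "elasticity s q = 1/2" "q > 0" and "\<epsilon> > 0"
  shows "\<epsilon> < goodput s q \<Longrightarrow> card {y. y > 0 \<and> goodput s y = \<epsilon>} = 2"
    and "\<epsilon> = goodput s q \<Longrightarrow> {y. y > 0 \<and> goodput s y = \<epsilon>} = {q}"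
    and "\<epsilon> > goodput s q \<Longrightarrow> {y. y > 0 \<and> goodput s y = \<epsilon>} = {}"
proof -
  have max: "goodput s y < goodput s q" if "y > 0" "y \<noteq> q" for y
    using goodput_inc[OF s q(1), of y q] goodput_dec[OF s q, of q y] that
    by (cases y q rule: linorder_cases) auto
  show "{y. y > 0 \<and> goodput s y = \<epsilon>} = {q}" if eq: "\<epsilon> = goodput s q"
  proof (intro equalityI subsetI)
    fix y assume "y \<in> {y. y > 0 \<and> goodput s y = \<epsilon>}"
    then show "y \<in> {q}" using max[of y] eq by (cases "y = q") auto
  qed (use q(2) eq in simp)
  show "{y. y > 0 \<and> goodput s y = \<epsilon>} = {}" if gt: "\<epsilon> > goodput s q"
  proof -
    have "goodput s y < \<epsilon>" if "y > 0" for y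
      using max[OF that] gt by (cases "y = q") auto
    then show ?thesis by force
  qed
  assume less: "\<epsilon> < goodput s q"
  define a where "a = \<epsilon> / (real s)\<^sup>2"
  define b where "b = 1 / \<epsilon>"
  have a: "a > 0" "goodput s a \<le> \<epsilon>" and b: "b > 0" "goodput s b \<le> \<epsilon>"
    using goodput_le(1)[of s a] goodput_le(2)[of s b] s \<open>\<epsilon> > 0\<close> by (auto simp: a_def b_def)
  have "a \<le> q"
    using goodput_le(1)[OF s q(2)] less s by (simp add: a_def field_simps)
  have "q \<le> b"
  proof -
    have "\<epsilon> \<le> 1 / q" using goodput_le(2)[OF s q(2)] less by linarith
    then show ?thesis using q(2) \<open>\<epsilon> > 0\<close> by (simp add: b_def field_simps)
  qed
  have cont: "continuous_on {c..d} (goodput s)" if "c > 0" for c d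
    unfolding goodput_def using that by (intro continuous_intros continuous_carried) auto
  obtain y where y: "a \<le> y" "y \<le> q" "goodput s y = \<epsilon>"
    using IVT'[of "goodput s" a \<epsilon> q] a less \<open>a \<le> q\<close> cont[of a q] by auto
  obtain z where z: "q \<le> z" "z \<le> b" "goodput s z = \<epsilon>"
    using IVT2'[of "goodput s" b \<epsilon> q] b less \<open>q \<le> b\<close> cont[of q b] q by auto
  have "y < q" "q < z" using y z less by (auto simp: less_le)
  have "{y. y > 0 \<and> goodput s y = \<epsilon>} = {y, z}"
  proof (intro equalityI subsetI)
    fix t assume t: "t \<in> {y. y > 0 \<and> goodput s y = \<epsilon>}"
    show "t \<in> {y, z}"
    proof (cases "t \<le> q")
      case True
      then have "t = y"
        using goodput_inc[OF s q(1), of t y] goodput_inc[OF s q(1), of y t] t y a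
        by (cases t y rule: linorder_cases) auto
      then show ?thesis by simp
    next
      case False
      then have "t = z"
        using goodput_dec[OF s q, of t z] goodput_dec[OF s q, of z t] t z
        by (cases t z rule: linorder_cases) auto
      then show ?thesis by simp
    qed
  qed (use y z a q in auto)
  then show "card {y. y > 0 \<and> goodput s y = \<epsilon>} = 2" using \<open>y < q\<close> \<open>q < z\<close> by simp
qed

section \<open>The retrial queue in terms of the reciprocal load\<close>

text \<open>With \<open>x = \<lambda> + \<Omega>\<close> the equation for the retrial rate says that an offered load \<open>x\<close> has
  carried load \<open>\<lambda>\<close>, and the carried load determines the offered one.\<close>

lemma retrial_fixpoint_iff:
  assumes "s \<ge> 1" "y > 0" "x > 0"
  shows "x - carried s y = x * erlang_B s x \<longleftrightarrow> x = 1 / y"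
proof -
  have "x * erlang_B s x = x - carried s (1 / x)"
    using accepted_fraction[of "1/x" s] assms by (simp add: erlang_B_recip field_simps)
  then have "x - carried s y = x * erlang_B s x \<longleftrightarrow> carried s (1 / x) = carried s y" by auto
  also have "\<dots> \<longleftrightarrow> 1 / x = y"
    using carried_inj[OF assms(1)] assms by (auto dest: inj_onD)
  finally show ?thesis using assms by (auto simp: field_simps)
qed

lemma retrial_rate_carried:
  assumes "s \<ge> 1" "y > 0"
  shows "retrial_rate s (carried s y) = 1 / y - carried s y"
  unfolding retrial_rate_def
proof (rule the_equality)
  have "1 / y - carried s y > 0"
    using carried_less_inverse[of y s] assms by (simp add: field_simps)
  moreover have "1 / y - carried s y = 1 / y * erlang_B s (1 / y)"
    using retrial_fixpoint_iff[OF assms, of "1 / y"] assms by auto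
  moreover have "carried s y + (1 / y - carried s y) = 1 / y" by simp
  ultimately show "1 / y - carried s y > 0 \<and> 1 / y - carried s y =
      (carried s y + (1 / y - carried s y)) * erlang_B s (carried s y + (1 / y - carried s y))"
    by (simp only: simp_thms)
next
  fix w assume w: "w > 0 \<and> w = (carried s y + w) * erlang_B s (carried s y + w)"
  then show "w = 1 / y - carried s y"
    using retrial_fixpoint_iff[OF assms, of "carried s y + w"] carried_pos[of s y] assms by auto
qed

text \<open>Scaling by \<open>\<surd>s\<close> turns the equation for \<open>a\<close> into that for \<open>\<Omega>\<close>, but the side
  condition only gives \<open>x \<ge> 0\<close> for the total load. The value \<open>x = 0\<close> must be excluded:
  there \<open>x - \<lambda> = x B(s, x)\<close> would read \<open>- \<lambda> = 0\<close>, but \<open>\<lambda> > 0\<close>.\<close>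

lemma retrial_a_carried:
  assumes "s \<ge> 1" "y > 0"
  shows "retrial_a s ((real s - carried s y) / sqrt (real s)) = (1 / y - carried s y) / sqrt (real s)"
proof -
  define r where "r = sqrt (real s)"
  have r: "r > 0" "real s = r * r" using assms by (auto simp: r_def)
  define \<gamma> where "\<gamma> = (real s - carried s y) / r"
  have key: "(\<gamma> - a \<le> r \<and> a = scaled_overflow s (\<gamma> - a)) \<longleftrightarrow> a = (1 / y - carried s y) / r" for a
  proof -
    define x where "x = carried s y + a * r"
    have load: "real s - (\<gamma> - a) * r = x"
      using r by (simp add: x_def \<gamma>_def field_simps)
    have "r * (1 - (\<gamma> - a) / r) = x / r"
      using r load by (simp add: field_simps)
    then have so: "scaled_overflow s (\<gamma> - a) = x / r * erlang_B s x"
      using load by (simp add: scaled_overflow_def flip: r_def)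
    have dom: "\<gamma> - a \<le> r \<longleftrightarrow> x \<ge> 0"
    proof -
      have "x = r * (r - (\<gamma> - a))" using load r by (simp add: algebra_simps)
      then show ?thesis using r by (simp add: zero_le_mult_iff)
    qed
    have "a = scaled_overflow s (\<gamma> - a) \<longleftrightarrow> x - carried s y = x * erlang_B s x"
      using r by (simp add: so x_def field_simps)
    moreover have "x \<noteq> 0" if "x - carried s y = x * erlang_B s x"
      using that carried_pos[of s y] assms by auto
    ultimately have "(\<gamma> - a \<le> r \<and> a = scaled_overflow s (\<gamma> - a)) \<longleftrightarrow> x > 0 \<and> x - carried s y = x * erlang_B s x"
      using dom by auto
    also have "\<dots> \<longleftrightarrow> x = 1 / y"
      using retrial_fixpoint_iff[OF assms, of x] assms by auto
    also have "\<dots> \<longleftrightarrow> a = (1 / y - carried s y) / r"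
      using r by (auto simp: x_def field_simps)
    finally show ?thesis .
  qed
  then show ?thesis
    unfolding retrial_a_def by (simp add: \<gamma>_def flip: r_def)
qed

lemma load_solutions_carried:
  assumes "s \<ge> 1"
  shows "load_solutions s \<epsilon> = carried s ` {y. y > 0 \<and> goodput s y = \<epsilon>}"
proof -
  have val: "carried s y * (1 - erlang_B s (carried s y + retrial_rate s (carried s y))) = goodput s y"
    if "y > 0" for y
    using that assms accepted_fraction[of y s]
    by (simp add: retrial_rate_carried erlang_B_recip goodput_def power2_eq_square mult_ac)
  show ?thesis
  proof (intro equalityI subsetI)
    fix l assume l: "l \<in> load_solutions s \<epsilon>"
    then obtain y where "y > 0" "carried s y = l"
      using carried_onto[OF assms, of l] by (auto simp: load_solutions_def)
    then show "l \<in> carried s ` {y. y > 0 \<and> goodput s y = \<epsilon>}"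
      using l val[of y] by (auto simp: load_solutions_def)
  qed (use val assms carried_pos[of s] carried_less_s[of s] in \<open>auto simp: load_solutions_def\<close>)
qed

text \<open>For \<open>\<gamma> = (s - \<lambda>) / \<surd>s\<close> one has \<open>\<gamma> a = \<lambda> p / s\<close> and \<open>1 - \<gamma> / \<surd>s = \<lambda> / s\<close>, so the
  defining equation becomes \<open>p = 1 / 2\<close>.\<close>

lemma gamma_hat_carried:
  assumes s: "s \<ge> 1" and q: "q > 0" "elasticity s q = 1/2"
  shows "gamma_hat s = (real s - carried s q) / sqrt (real s)"
proof -
  define r where "r = sqrt (real s)"
  have r: "r > 0" "real s = r * r" using assms by (auto simp: r_def)
  have crit: "(real s - carried s y) / r * retrial_a s ((real s - carried s y) / r)
        = 1 / 2 * (1 - (real s - carried s y) / r / r) \<longleftrightarrow> y = q" if y: "y > 0" for y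
  proof -
    let ?c = "carried s y" and ?u = "poly (recip_B s) y"
    have pos: "?c > 0" "?u > 0" using carried_pos recip_pos s y by auto
    have "retrial_a s ((real s - ?c) / r) = 1 / (y * ?u) / r"
      using retrial_a_carried[OF s y] accepted_fraction[OF y, of s] y by (simp add: r_def field_simps)
    moreover have "real s - ?c = y * ?u * ?c * elasticity s y"
      by (rule elasticity_carried[OF s y])
    ultimately have "(real s - ?c) / r * retrial_a s ((real s - ?c) / r) = ?c * elasticity s y / (r * r)"
      using pos y by simp
    moreover have "1 / 2 * (1 - (real s - ?c) / r / r) = ?c / 2 / (r * r)"
      using r by (simp add: field_simps)
    moreover have "?c * elasticity s y / (r * r) = ?c / 2 / (r * r) \<longleftrightarrow> elasticity s y = 1/2"
      using pos(1) r(1) by (simp add: field_simps)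
    moreover have "elasticity s y = 1/2 \<longleftrightarrow> y = q"
      using elasticity_less[of s y q] elasticity_less[of s q y] q s y
      by (cases y q rule: linorder_cases) auto
    ultimately show ?thesis by (simp only:)
  qed
  show ?thesis unfolding gamma_hat_def r_def [symmetric]
  proof (rule the_equality)
    have "0 < (real s - carried s q) / r" using carried_less_s[OF s q(1)] r by simp
    moreover have "(real s - carried s q) / r < r"
      using carried_pos[of s q] s q r by (simp add: field_simps)
    ultimately show "0 < (real s - carried s q) / r \<and> (real s - carried s q) / r < r \<and>
        (real s - carried s q) / r * retrial_a s ((real s - carried s q) / r)
          = 1 / 2 * (1 - (real s - carried s q) / r / r)"
      using crit[OF q(1)] by simp
  next
    fix g assume g: "0 < g \<and> g < r \<and> g * retrial_a s g = 1 / 2 * (1 - g / r)"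
    have "0 < real s - g * r" "real s - g * r < real s" using g r by auto
    then obtain y where y: "y > 0" "carried s y = real s - g * r"
      using carried_onto[OF s] by blast
    then have "g = (real s - carried s y) / r" using r by simp
    then show "g = (real s - carried s q) / r" using crit[OF y(1)] g by simp
  qed
qed

theorem theorem11:
  fixes s :: nat and \<epsilon> :: real
  assumes "s \<ge> 1" and "\<epsilon> > 0"
  shows "(\<epsilon> < sqrt (real s) * L_fun s (gamma_hat s) \<longrightarrow> card (load_solutions s \<epsilon>) = 2) \<and>
         (\<epsilon> = sqrt (real s) * L_fun s (gamma_hat s) \<longrightarrow> card (load_solutions s \<epsilon>) = 1) \<and>
         (\<epsilon> > sqrt (real s) * L_fun s (gamma_hat s) \<longrightarrow> load_solutions s \<epsilon> = {}) \<and>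
         L_fun s (gamma_hat s) =
           gamma_hat s / (gamma_hat s + 1 / (2 * sqrt (real s))) * (sqrt (real s) - gamma_hat s)"
proof -
  define r where "r = sqrt (real s)"
  have r: "r > 0" "real s = r * r" using assms by (auto simp: r_def)
  obtain q where q: "q > 0" "elasticity s q = 1/2" using elasticity_half[OF assms(1)] .
  define c where "c = carried s q"
  define u where "u = poly (recip_B s) q"
  have pos: "c > 0" "u > 0" using carried_pos recip_pos assms q by (auto simp: c_def u_def)
  have g: "gamma_hat s = (real s - c) / r"
    using gamma_hat_carried[OF assms(1) q] by (simp add: c_def r_def)
  have a: "retrial_a s (gamma_hat s) = (1 / q - c) / r"
    using retrial_a_carried[OF assms(1) q(1)] g by (simp add: c_def r_def)
  have rg: "r - gamma_hat s = c / r" using r by (simp add: g field_simps)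
  have "r - gamma_hat s + retrial_a s (gamma_hat s) = 1 / q / r"
    unfolding rg a by (simp add: diff_divide_distrib)
  then have "L_fun s (gamma_hat s) = (c / r)\<^sup>2 / (1 / q / r)"
    by (simp add: L_fun_def rg flip: r_def)
  then have L: "L_fun s (gamma_hat s) = q * c\<^sup>2 / r"
    using r q by (simp add: field_simps power2_eq_square)
  then have level: "r * L_fun s (gamma_hat s) = goodput s q"
    using r by (simp add: goodput_def c_def)
  \<comment> \<open>The closed form: at the mode \<open>s - \<lambda> = q u \<lambda> / 2\<close>, and \<open>q u \<lambda> + 1 = q v + 1 = u\<close>.\<close>
  have idle: "real s - c = q * u * c / 2"
    using elasticity_carried[OF assms(1) q(1)] q by (simp add: c_def u_def)
  have qcu: "q * u * c + 1 = u"
    using accepted_fraction[OF q(1), of s] pos by (simp add: c_def u_def field_simps)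
  have "gamma_hat s / (gamma_hat s + 1 / (2 * r)) = q * u * c / (q * u * c + 1)"
    unfolding g idle using r pos q by (simp add: field_simps)
  also have "\<dots> = q * c"
    unfolding qcu using pos by simp
  finally have formula: "L_fun s (gamma_hat s) = gamma_hat s / (gamma_hat s + 1 / (2 * r)) * (r - gamma_hat s)"
    by (simp add: L rg power2_eq_square)
  have inj: "inj_on (carried s) {y. y > 0 \<and> goodput s y = \<epsilon>}"
    using carried_inj[OF assms(1)] by (rule inj_on_subset) auto
  note lev = goodput_level[OF assms(1) q(2) q(1) assms(2)]
  have "card (load_solutions s \<epsilon>) = card {y. y > 0 \<and> goodput s y = \<epsilon>}"
    unfolding load_solutions_carried[OF assms(1)] by (rule card_image[OF inj])
  then show ?thesis
    unfolding r_def [symmetric] level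
    using lev formula load_solutions_carried[OF assms(1), of \<epsilon>] by auto
qed

end
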